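(* If $(K,P,N)$ and $(\hat K,\hat P,\hat N)$ are affine-equivalent finite elements, then the transformation matrix $M$, defined by $\Psi=MF^*(\hat\Psi)$, is the identity.
   Context: For a domain $\Omega\subset\mathbb{R}^d$, $C_b^k(\Omega)$ is the space of functions with continuous and bounded derivatives up to and including order $k$ over $\Omega$, and $C_b^k(\Omega)'$ is its topological dual. A finite element is a triple $(K,P,N)$ where $K\subset\mathbb{R}^d$ is a bounded domain, $P\subset C_b^k(K)$ for some integer $k\ge 0$ is a finite-dimensional function space, and $N=\{n_i\}_{i=1}^\nu\subset C_b^k(K)'$ is a collection of linearly independent functionals (nodes) whose actions restricted to $P$ form a basis for $P'$. With a slight abuse of notation, $N$ also denotes the vector $[n_1\ n_2\ \cdots\ n_\nu]^T$. The nodal basis for $P$ is the set $\{\psi_i\}_{i=1}^\nu\subset P$ such that $n_i(\psi_j)=\delta_{i,j}$ for $1\le i,j\le\nu$; it is also written as the vector $\Psi=(\psi_1,\dots,\psi_\nu)$. The same notation with hats is used for the reference element $(\hat K,\hat P,\hat N)$. Let $F:K\to\hat K$ be the affine geometric mapping. The pull-back $F^*:C_b^k(\hat K)\to C_b^k(K)$ is $F^*(\hat f)=\hat f\circ F$, and the push-forward $F_*:C_b^k(K)'\to C_b^k(\hat K)'$ is $F_*(n)=n\circ F^*$; both act entrywise on vectors. Finite elements $(K,P,N)$ and $(\hat K,\hat P,\hat N)$, with $F$ an affine mapping on $K$, are affine equivalent if $F(K)=\hat K$, $F^*(\hat P)=P$ (in the sense of equality of vector spaces), and $F_*(N)=\hat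 N$ (in the sense of equality of finite sets). When $F(K)=\hat K$ and $F^*(\hat P)=P$, the entries of $F^*(\hat\Psi)$ form a basis for $P$, so there is an invertible $\nu\times\nu$ matrix $M$ with $\Psi=MF^*(\hat\Psi)$, i.e. $\psi_i=\sum_{j=1}^\nu M_{ij}F^*(\hat\psi_j)$; this is the transformation matrix.
   Formalization: Since F_*(N) = N̂ is only an equality of sets, M is in general a permutation matrix; the claim M = I is stated for numberings with F_*(n_i) = n̂_i for every i, and such a numbering of N is shown to exist for each numbering of N̂. *)

theory Defs
  imports "HOL-Analysis.Analysis" "HOL-Library.Function_Algebras" "Jordan_Normal_Form.Matrix"
begin

instantiation "fun" :: (type, real_vector) real_vector
begin

definition scaleR_fun_def: "scaleR c f = (\<lambda>x. c *\<^sub>R f x)"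

instance
  by standard (simp_all add: fun_eq_iff scaleR_fun_def scaleR_add_right scaleR_add_left)

end

text \<open>
  A function on a set \<open>A\<close> is represented by its extension by zero to the whole type.
  Thus equality of functions on \<open>A\<close> is equality in HOL, and spaces of functions (and of
  functionals) are subspaces of the ambient function type with its pointwise operations.
\<close>

definition zero_ext :: "'b set \<Rightarrow> ('b \<Rightarrow> real) \<Rightarrow> 'b \<Rightarrow> real" where
  "zero_ext A f = (\<lambda>x. if x \<in> A then f x else 0)"

definition partial :: "'a::euclidean_space set \<Rightarrow> 'a \<Rightarrow> ('a \<Rightarrow> real) \<Rightarrow> 'a \<Rightarrow> real" where
  "partial K b f = zero_ext K (\<lambda>x. deriv (\<lambda>t. f (x + t *\<^sub>R b)) 0)"

text \<open>\<open>partials K [b\<^sub>1, \<dots>, b\<^sub>m] f\<close> is the mixed partial derivative of \<open>f\<close> of order \<open>m\<close>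
  in the coordinate directions \<open>b\<^sub>1, \<dots>, b\<^sub>m\<close>.\<close>

definition partials :: "'a::euclidean_space set \<Rightarrow> 'a list \<Rightarrow> ('a \<Rightarrow> real) \<Rightarrow> 'a \<Rightarrow> real" where
  "partials K bs f = foldr (partial K) bs f"

definition directions :: "nat \<Rightarrow> 'a::euclidean_space list set" where
  "directions k = {bs. set bs \<subseteq> Basis \<and> length bs \<le> k}"

text \<open>The first condition on derivatives states existence, since \<open>deriv\<close> is total.\<close>

definition Cb :: "nat \<Rightarrow> 'a::euclidean_space set \<Rightarrow> ('a \<Rightarrow> real) set" where
  "Cb k K = {f. (\<forall>x. x \<notin> K \<longrightarrow> f x = 0) \<and>
     (\<forall>bs b x. b # bs \<in> directions k \<and> x \<in> K \<longrightarrow>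
        (\<lambda>t. partials K bs f (x + t *\<^sub>R b)) field_differentiable (at 0)) \<and>
     (\<forall>bs \<in> directions k. continuous_on K (partials K bs f) \<and> bounded (partials K bs f ` K))}"

definition Cb_norm :: "nat \<Rightarrow> 'a::euclidean_space set \<Rightarrow> ('a \<Rightarrow> real) \<Rightarrow> real" where
  "Cb_norm k K f = (SUP (bs, x) \<in> directions k \<times> K. \<bar>partials K bs f x\<bar>)"

text \<open>The topological dual of a subspace \<open>V\<close> of \<open>Cb k K\<close>, normed by \<open>Cb_norm k K\<close>.\<close>

definition top_dual ::
    "nat \<Rightarrow> 'a::euclidean_space set \<Rightarrow> ('a \<Rightarrow> real) set \<Rightarrow> (('a \<Rightarrow> real) \<Rightarrow> real) set" where
  "top_dual k K V = {n. (\<forall>f. f \<notin> V \<longrightarrow> n f = 0) \<and>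
     (\<forall>f \<in> V. \<forall>g \<in> V. n (f + g) = n f + n g) \<and>
     (\<forall>c. \<forall>f \<in> V. n (c *\<^sub>R f) = c * n f) \<and>
     (\<exists>C. \<forall>f \<in> V. \<bar>n f\<bar> \<le> C * Cb_norm k K f)}"

text \<open>Injectivity of the restriction to \<open>P\<close> is required because a basis is a family
  indexed by the nodes: two nodes must not have the same action on \<open>P\<close>.\<close>

definition finite_element ::
    "nat \<Rightarrow> 'a::euclidean_space set \<Rightarrow> ('a \<Rightarrow> real) set \<Rightarrow> (('a \<Rightarrow> real) \<Rightarrow> real) set \<Rightarrow> bool" where
  "finite_element k K P N \<longleftrightarrow>
     open K \<and> connected K \<and> K \<noteq> {} \<and> bounded K \<and>
     P \<subseteq> Cb k K \<and> (\<exists>B. finite B \<and> P = span B) \<and>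
     N \<subseteq> top_dual k K (Cb k K) \<and> finite N \<and> independent N \<and>
     inj_on (zero_ext P) N \<and> independent (zero_ext P ` N) \<and>
     span (zero_ext P ` N) = top_dual k K P"

definition numbering :: "'b set \<Rightarrow> (nat \<Rightarrow> 'b) \<Rightarrow> bool" where
  "numbering N n \<longleftrightarrow> bij_betw n {..<card N} N"

definition nodal_basis ::
    "nat \<Rightarrow> ('a \<Rightarrow> real) set \<Rightarrow> (nat \<Rightarrow> ('a \<Rightarrow> real) \<Rightarrow> real) \<Rightarrow> (nat \<Rightarrow> 'a \<Rightarrow> real) \<Rightarrow> bool" where
  "nodal_basis \<nu> P n \<psi> \<longleftrightarrow>
     (\<forall>j<\<nu>. \<psi> j \<in> P) \<and> (\<forall>i<\<nu>. \<forall>j<\<nu>. n i (\<psi> j) = (if i = j then 1 else 0))"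

definition affine_map_on :: "'a::euclidean_space set \<Rightarrow> ('a \<Rightarrow> 'a) \<Rightarrow> bool" where
  "affine_map_on K F \<longleftrightarrow> (\<exists>A b. linear A \<and> (\<forall>x \<in> K. F x = A x + b))"

definition pull_back :: "'a set \<Rightarrow> ('a \<Rightarrow> 'a) \<Rightarrow> ('a \<Rightarrow> real) \<Rightarrow> 'a \<Rightarrow> real" where
  "pull_back K F f = zero_ext K (f \<circ> F)"

text \<open>\<open>K\<close> is the source and \<open>K'\<close> the target of \<open>F\<close>.\<close>

definition push_forward ::
    "nat \<Rightarrow> 'a::euclidean_space set \<Rightarrow> 'a set \<Rightarrow> ('a \<Rightarrow> 'a) \<Rightarrow>
     (('a \<Rightarrow> real) \<Rightarrow> real) \<Rightarrow> ('a \<Rightarrow> real) \<Rightarrow> real" where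
  "push_forward k K K' F n = zero_ext (Cb k K') (n \<circ> pull_back K F)"

text \<open>The nodes are compared as sets, irrespective of any numbering.\<close>

definition affine_equivalent ::
    "nat \<Rightarrow> ('a::euclidean_space \<Rightarrow> 'a) \<Rightarrow>
     'a set \<Rightarrow> ('a \<Rightarrow> real) set \<Rightarrow> (('a \<Rightarrow> real) \<Rightarrow> real) set \<Rightarrow>
     'a set \<Rightarrow> ('a \<Rightarrow> real) set \<Rightarrow> (('a \<Rightarrow> real) \<Rightarrow> real) set \<Rightarrow> bool" where
  "affine_equivalent k F K P N K' P' N' \<longleftrightarrow>
     affine_map_on K F \<and> F ` K = K' \<and> pull_back K F ` P' = P \<and> push_forward k K K' F ` N = N'"

definition transformation_matrix ::
    "nat \<Rightarrow> 'a set \<Rightarrow> ('a \<Rightarrow> 'a) \<Rightarrow> (nat \<Rightarrow> 'a \<Rightarrow> real) \<Rightarrow> (nat \<Rightarrow> 'a \<Rightarrow> real) \<Rightarrow> real mat" where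
  "transformation_matrix \<nu> K F \<psi> \<psi>' =
     (THE M. M \<in> carrier_mat \<nu> \<nu> \<and>
        (\<forall>i<\<nu>. \<psi> i = (\<Sum>j<\<nu>. M $$ (i, j) *\<^sub>R pull_back K F (\<psi>' j))))"

end

theory Submission
  imports Defs
begin

text \<open>
  If \<open>f' \<in> P'\<close> and \<open>n\<close> is a node of \<open>K\<close>, then \<open>push_forward k K K' F n f' = n (pull_back K F f')\<close>.
  This duality gives everything. Suppose that \<open>n\<^sub>i\<close> is pushed forward to \<open>n\<^sub>i'\<close>, and let \<open>\<psi>\<^sub>j'\<close> be
  the nodal basis of the reference element. Then
  \<open>n\<^sub>i (F\<^sup>* \<psi>\<^sub>j') = (F\<^sub>* n\<^sub>i) \<psi>\<^sub>j' = n\<^sub>i' \<psi>\<^sub>j' = \<delta>\<^sub>i\<^sub>j\<close>, so the pulled-back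
  functions form a nodal basis of \<open>P\<close>, and since a nodal basis is determined by the nodes,
  \<open>\<psi>\<^sub>j = F\<^sup>*(\<psi>\<^sub>j')\<close>. The identity is therefore a transformation matrix; it is the only
  one, because applying \<open>n\<^sub>j\<close> to the \<open>i\<close>-th defining equation isolates the entry \<open>M\<^sub>i\<^sub>j\<close>.

  Two facts make this rigorous. Uniqueness of the nodal basis needs that the nodes
  separate the points of \<open>P\<close>: they span the dual of \<open>P\<close>, and that dual contains the evaluations at
  the points of \<open>K\<close>, which are continuous because the norm bounds the values of a function
  (\<open>nodes_separate\<close>). The numbering of the nodes of \<open>K\<close> that matches a given numbering on the
  reference element exists because the push-forward is injective on nodes: by duality, two nodes
  with equal push-forward agree on \<open>P = F\<^sup>*(P')\<close>, hence coincide (\<open>push_forward_inj_on_nodes\<close>).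
\<close>

section \<open>Nodes separate the points of the function space\<close>

text \<open>Only finitely many partial derivatives, each of them bounded, enter the supremum, so it is a
  genuine upper bound; the empty list of directions contributes the values of \<open>f\<close> itself.\<close>

lemma abs_le_Cb_norm:
  assumes f: "f \<in> Cb k K" and x: "x \<in> K"
  shows "\<bar>f x\<bar> \<le> Cb_norm k K f"
proof -
  let ?h = "\<lambda>(bs, y). \<bar>partials K bs f y\<bar>"
  have fin: "finite (directions k :: 'a list set)"
    unfolding directions_def by (rule finite_lists_length_le) simp
  have "bdd_above (?h ` ({bs} \<times> K))" if bs: "bs \<in> directions k" for bs
  proof -
    from f bs have "bounded (partials K bs f ` K)"
      by (simp add: Cb_def)
    then obtain B where "\<And>y. y \<in> K \<Longrightarrow> \<bar>partials K bs f y\<bar> \<le> B"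
      by (auto simp: bounded_iff)
    then show ?thesis
      by (intro bdd_aboveI[of _ B]) auto
  qed
  then have "bdd_above (\<Union>bs\<in>directions k. ?h ` ({bs} \<times> K))"
    using fin by simp
  also have "(\<Union>bs\<in>directions k. ?h ` ({bs} \<times> K)) = ?h ` (directions k \<times> K)"
    by auto
  finally have bdd: "bdd_above (?h ` (directions k \<times> K))" .
  have "([], x) \<in> directions k \<times> K"
    using x by (simp add: directions_def)
  from cSUP_upper[OF this bdd] show ?thesis
    by (simp add: Cb_norm_def partials_def)
qed

lemma finite_element_subspace: "finite_element k K P N \<Longrightarrow> subspace P"
  unfolding finite_element_def by auto

lemma evaluation_in_top_dual:
  assumes P: "subspace P" "P \<subseteq> Cb k K" and x: "x \<in> K"
  shows "zero_ext P (\<lambda>f. f x) \<in> top_dual k K P"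
proof -
  have "\<forall>f\<in>P. \<bar>zero_ext P (\<lambda>f. f x) f\<bar> \<le> 1 * Cb_norm k K f"
    using abs_le_Cb_norm[OF _ x] P(2) by (auto simp: zero_ext_def)
  then show ?thesis
    unfolding top_dual_def
    using subspace_add[OF P(1)] subspace_scale[OF P(1)]
    by (auto simp: zero_ext_def scaleR_fun_def intro!: exI[of _ 1])
qed

text \<open>A function killed by all nodes is killed by their span, in particular by the evaluations.\<close>

lemma nodes_separate:
  assumes fe: "finite_element k K P N"
    and f: "f \<in> P" and zero: "\<And>n. n \<in> N \<Longrightarrow> n f = 0"
  shows "f = 0"
proof
  fix x
  have P: "subspace P" "P \<subseteq> Cb k K"
    using finite_element_subspace[OF fe] fe by (simp_all add: finite_element_def)
  show "f x = 0 x"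
  proof (cases "x \<in> K")
    case True
    have "subspace {m :: ('a \<Rightarrow> real) \<Rightarrow> real. m f = 0}"
      by (auto simp: subspace_def scaleR_fun_def)
    moreover have "zero_ext P ` N \<subseteq> {m. m f = 0}"
      using f zero by (auto simp: zero_ext_def)
    ultimately have "span (zero_ext P ` N) \<subseteq> {m. m f = 0}"
      by (intro span_minimal)
    moreover have "zero_ext P (\<lambda>f. f x) \<in> span (zero_ext P ` N)"
      using evaluation_in_top_dual[OF P True] fe by (simp add: finite_element_def)
    ultimately show ?thesis
      using f by (auto simp: zero_ext_def)
  next
    case False
    then show ?thesis
      using f P(2) by (auto simp: Cb_def)
  qed
qed

section \<open>Nodal bases\<close>

lemma node_linear:
  assumes fe: "finite_element k K P N" and n: "n \<in> N"
  shows "f \<in> P \<Longrightarrow> g \<in> P \<Longrightarrow> n (f + g) = n f + n g"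
    and "f \<in> P \<Longrightarrow> n (c *\<^sub>R f) = c * n f"
  using assms unfolding finite_element_def top_dual_def by blast+

lemma node_diff:
  assumes fe: "finite_element k K P N" and n: "n \<in> N" and f: "f \<in> P" and g: "g \<in> P"
  shows "n (f - g) = n f - n g"
proof -
  have "f - g \<in> P"
    using subspace_diff[OF finite_element_subspace[OF fe] f g] .
  from node_linear(1)[OF fe n this g] show ?thesis
    by simp
qed

text \<open>Nodes are linear only on \<open>C\<^sub>b\<^sup>k\<close>, and restricting to the subspace \<open>P\<close> keeps all partial
  sums inside the region of linearity.\<close>

lemma node_sum:
  assumes fe: "finite_element k K P N" and n: "n \<in> N"
    and I: "finite I" and g: "\<And>j. j \<in> I \<Longrightarrow> g j \<in> P"
  shows "n (\<Sum>j\<in>I. c j *\<^sub>R g j) = (\<Sum>j\<in>I. c j * n (g j))"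
proof -
  note S = finite_element_subspace[OF fe]
  from I g show ?thesis
  proof (induction I rule: finite_induct)
    case empty
    show ?case
      using node_linear(2)[OF fe n subspace_0[OF S], of 0] by (simp add: zero_fun_def)
  next
    case (insert i I)
    have "c i *\<^sub>R g i \<in> P" "(\<Sum>j\<in>I. c j *\<^sub>R g j) \<in> P"
      using insert.prems subspace_scale[OF S] by (auto intro!: subspace_sum[OF S])
    from node_linear(1)[OF fe n this]
    have "n (\<Sum>j\<in>insert i I. c j *\<^sub>R g j) = n (c i *\<^sub>R g i) + n (\<Sum>j\<in>I. c j *\<^sub>R g j)"
      by (simp only: sum.insert[OF insert.hyps])
    also have "\<dots> = c i * n (g i) + (\<Sum>j\<in>I. c j * n (g j))"
      using insert by (simp add: node_linear(2)[OF fe n])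
    finally show ?case
      by (simp only: sum.insert[OF insert.hyps])
  qed
qed

lemma numbering_mem: "numbering N n \<Longrightarrow> i < card N \<Longrightarrow> n i \<in> N"
  by (auto simp: numbering_def bij_betw_def)

lemma nodal_basis_unique:
  assumes fe: "finite_element k K P N" and num: "numbering N n"
    and \<psi>: "nodal_basis (card N) P n \<psi>" and \<phi>: "nodal_basis (card N) P n \<phi>"
    and j: "j < card N"
  shows "\<psi> j = \<phi> j"
proof -
  have mem: "\<psi> j \<in> P" "\<phi> j \<in> P"
    using \<psi> \<phi> j by (auto simp: nodal_basis_def)
  have "\<psi> j - \<phi> j = 0"
  proof (rule nodes_separate[OF fe])
    show "\<psi> j - \<phi> j \<in> P"
      using subspace_diff[OF finite_element_subspace[OF fe] mem] .
    fix m assume m: "m \<in> N"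
    then obtain i where "i < card N" "m = n i"
      using num by (auto simp: numbering_def bij_betw_def)
    then show "m (\<psi> j - \<phi> j) = 0"
      using node_diff[OF fe m mem] \<psi> \<phi> j by (simp add: nodal_basis_def)
  qed
  then show ?thesis
    by simp
qed

section \<open>Affine equivalence\<close>

text \<open>The zero extension in the definition of the push-forward is invisible on \<open>P' \<subseteq> C\<^sub>b\<^sup>k(K')\<close>.\<close>

lemma push_forward_apply:
  assumes "finite_element k K' P' N'" "f \<in> P'"
  shows "push_forward k K K' F n f = n (pull_back K F f)"
  using assms by (auto simp: finite_element_def push_forward_def zero_ext_def)

text \<open>The nodes of a finite element are told apart by their action on \<open>P\<close>, and the push-forward
  retains that action because every element of \<open>P\<close> is a pull-back.\<close>

lemma push_forward_inj_on_nodes: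
  assumes fe: "finite_element k K P N" and fe': "finite_element k K' P' N'"
    and P: "pull_back K F ` P' = P"
  shows "inj_on (push_forward k K K' F) N"
proof (rule inj_onI)
  fix m n assume mn: "m \<in> N" "n \<in> N"
    and eq: "push_forward k K K' F m = push_forward k K K' F n"
  have "m f = n f" if "f \<in> P" for f
  proof -
    from that P obtain f' where "f' \<in> P'" "f = pull_back K F f'"
      by auto
    then show ?thesis
      using push_forward_apply[OF fe', of f' K F] eq by metis
  qed
  then have "zero_ext P m = zero_ext P n"
    by (auto simp: zero_ext_def)
  with mn fe show "m = n"
    by (auto simp: finite_element_def dest: inj_onD)
qed

lemma pull_back_nodal_basis:
  assumes fe': "finite_element k K' P' N'" and P: "pull_back K F ` P' = P"
    and n: "\<And>i. i < \<nu> \<Longrightarrow> push_forward k K K' F (n i) = n' i"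
    and \<psi>': "nodal_basis \<nu> P' n' \<psi>'"
  shows "nodal_basis \<nu> P n (\<lambda>j. pull_back K F (\<psi>' j))"
proof -
  have "n i (pull_back K F (\<psi>' j)) = n' i (\<psi>' j)" if "i < \<nu>" "j < \<nu>" for i j
    using push_forward_apply[OF fe', of "\<psi>' j" K F "n i"] n[OF that(1)] \<psi>' that(2)
    by (simp add: nodal_basis_def)
  with P \<psi>' show ?thesis
    by (auto simp: nodal_basis_def)
qed

section \<open>The transformation matrix\<close>

text \<open>\<open>transformation_matrix\<close> is a definite description, so besides satisfying the defining
  equation the identity has to be shown to be its only solution. It is a
  solution because both families are nodal bases of \<open>P\<close> and hence equal; it is the only one because
  \<open>n\<^sub>j\<close> applied to the \<open>i\<close>-th equation turns the left side into \<open>\<delta>\<^sub>i\<^sub>j\<close> and the right side into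
  \<open>M\<^sub>i\<^sub>j\<close>.\<close>

lemma transformation_matrix_eq_one:
  assumes fe: "finite_element k K P N" and num: "numbering N n"
    and \<psi>: "nodal_basis (card N) P n \<psi>"
    and \<phi>: "nodal_basis (card N) P n (\<lambda>j. pull_back K F (\<psi>' j))"
  shows "transformation_matrix (card N) K F \<psi> \<psi>' = 1\<^sub>m (card N)"
  unfolding transformation_matrix_def
proof (rule the_equality, intro conjI allI impI)
  let ?\<phi> = "\<lambda>j. pull_back K F (\<psi>' j)"
  show "1\<^sub>m (card N) \<in> carrier_mat (card N) (card N)"
    by simp
  fix i assume i: "i < card N"
  have "(\<Sum>j<card N. 1\<^sub>m (card N) $$ (i, j) *\<^sub>R ?\<phi> j) =
      (\<Sum>j<card N. if i = j then ?\<phi> j else 0)"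
    using i by (intro sum.cong) auto
  also have "\<dots> = ?\<phi> i"
    using i by simp
  finally show "\<psi> i = (\<Sum>j<card N. 1\<^sub>m (card N) $$ (i, j) *\<^sub>R ?\<phi> j)"
    using nodal_basis_unique[OF fe num \<psi> \<phi> i] by simp
next
  let ?\<phi> = "\<lambda>j. pull_back K F (\<psi>' j)"
  fix M
  assume M: "M \<in> carrier_mat (card N) (card N) \<and>
    (\<forall>i<card N. \<psi> i = (\<Sum>j<card N. M $$ (i, j) *\<^sub>R ?\<phi> j))"
  have "M $$ (i, j) = 1\<^sub>m (card N) $$ (i, j)" if ij: "i < card N" "j < card N" for i j
  proof -
    have "n j (\<psi> i) = n j (\<Sum>l<card N. M $$ (i, l) *\<^sub>R ?\<phi> l)"
      using M ij by simp
    also have "\<dots> = (\<Sum>l<card N. M $$ (i, l) * n j (?\<phi> l))"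
      using \<phi> by (intro node_sum[OF fe numbering_mem[OF num ij(2)]]) (auto simp: nodal_basis_def)
    also have "\<dots> = (\<Sum>l<card N. if j = l then M $$ (i, l) else 0)"
      using \<phi> ij by (intro sum.cong) (auto simp: nodal_basis_def)
    also have "\<dots> = M $$ (i, j)"
      using ij by simp
    finally show ?thesis
      using \<psi> ij by (auto simp: nodal_basis_def)
  qed
  with M show "M = 1\<^sub>m (card N)"
    by (intro eq_matI) auto
qed

theorem theorem3p2:
  fixes F :: "'a::euclidean_space \<Rightarrow> 'a"
    and K Kh :: "'a set" and P Ph :: "('a \<Rightarrow> real) set"
    and N Nh :: "(('a \<Rightarrow> real) \<Rightarrow> real) set"
    and nh :: "nat \<Rightarrow> ('a \<Rightarrow> real) \<Rightarrow> real" and k :: nat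
  assumes "finite_element k K P N"
    and "finite_element k Kh Ph Nh"
    and "affine_equivalent k F K P N Kh Ph Nh"
    and "numbering Nh nh"
  shows "card N = card Nh \<and>
    (\<exists>n. numbering N n \<and> (\<forall>i<card N. push_forward k K Kh F (n i) = nh i)) \<and>
    (\<forall>n \<psi> \<psi>h. numbering N n \<and> (\<forall>i<card N. push_forward k K Kh F (n i) = nh i) \<and>
       nodal_basis (card N) P n \<psi> \<and> nodal_basis (card N) Ph nh \<psi>h \<longrightarrow>
       transformation_matrix (card N) K F \<psi> \<psi>h = 1\<^sub>m (card N))"
proof (intro conjI allI impI)
  let ?p = "push_forward k K Kh F"
  have P: "pull_back K F ` Ph = P" and Nh: "?p ` N = Nh"
    using assms(3) by (simp_all add: affine_equivalent_def)
  have bij: "bij_betw ?p N Nh"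
    using push_forward_inj_on_nodes[OF assms(1,2) P] Nh by (simp add: bij_betw_def)
  show card: "card N = card Nh"
    using bij by (rule bij_betw_same_card)
  show "\<exists>n. numbering N n \<and> (\<forall>i<card N. ?p (n i) = nh i)"
  proof (intro exI conjI allI impI)
    show "numbering N (inv_into N ?p \<circ> nh)"
      using assms(4) card bij_betw_trans[OF _ bij_betw_inv_into[OF bij]]
      by (simp add: numbering_def)
    fix i assume "i < card N"
    then show "?p ((inv_into N ?p \<circ> nh) i) = nh i"
      using numbering_mem[OF assms(4)] card bij_betw_inv_into_right[OF bij] by simp
  qed
  fix n \<psi> \<psi>h
  assume "numbering N n \<and> (\<forall>i<card N. ?p (n i) = nh i) \<and>
    nodal_basis (card N) P n \<psi> \<and> nodal_basis (card N) Ph nh \<psi>h"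
  then show "transformation_matrix (card N) K F \<psi> \<psi>h = 1\<^sub>m (card N)"
    by (intro transformation_matrix_eq_one[OF assms(1)]
        pull_back_nodal_basis[OF assms(2) P, where n' = nh]) auto
qed

end
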